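(* Let $G$ be a group. Then there exists a band $B_G$ such that the free idempotent generated semigroup $\mathsf{IG}(B_G)$ over $B_G$ has a maximal subgroup isomorphic to $G$. Furthermore, if $G$ is finitely presented, then $B_G$ can be constructed to be finite; that is, for every finitely presented group $G$ there exists a finite band $B_G$ such that $\mathsf{IG}(B_G)$ has a maximal subgroup isomorphic to $G$.
   Context: A band is a semigroup $B$ in which every element is idempotent ($e^2=e$ for all $e\in B$). For a semigroup $S$, let $E=E(S)$ denote its set of idempotents. A pair $\{e,f\}$ of idempotents of $S$ is called a basic pair if $\{ef,fe\}\cap\{e,f\}\neq\emptyset$, the products being computed in $S$; if $\{e,f\}$ is a basic pair then both $ef$ and $fe$ are idempotents of $S$. The biordered set of $S$ is the set $E(S)$ regarded as a partial algebra, in which only the products of basic pairs are retained. The free idempotent generated semigroup over $E$ (also called the free idempotent generated semigroup over $S$) is the semigroup defined by the semigroup presentation $$\mathsf{IG}(E)=\langle E \mid e\cdot f=ef \ (\{e,f\}\text{ is a basic pair})\rangle,$$ where $e\cdot f$ denotes the word of length $2$ in the free semigroup $E^+$ and $ef$ denotes the element of $E$ equal to the product of $e$ and $f$ in $S$ (for each basic pair both relations $e\cdot f=ef$ and $f\cdot e=fe$ are included). For a band $B$ we have $E(B)=B$, and $\mathsf{IG}(B)$ denotes $\mathsf{IG}(E(B))$. A maximal subgroup of a semigroup $T$ is a subsemigroup of $T$ that is a group under the multiplication of $T$ (its identity being some idempotent of $T$, not necessarily an identity of $T$) and that is maximal with respect to inclusion among such subsemigroups; equivalently, it is the $\mathscr{H}$-class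 (for Green's relation $\mathscr{H}$) of an idempotent of $T$. *)

theory Defs
  imports "HOL-Algebra.Coset"
begin

text \<open>
  Semigroups are given by a carrier set \<open>S\<close> and an operation \<open>m\<close>; the values of \<open>m\<close> outside \<open>S\<close>
  are irrelevant. Groups are those of HOL-Algebra.
\<close>

definition is_semigroup :: "'b set \<Rightarrow> ('b \<Rightarrow> 'b \<Rightarrow> 'b) \<Rightarrow> bool" where
  "is_semigroup S m \<longleftrightarrow>
     (\<forall>x\<in>S. \<forall>y\<in>S. m x y \<in> S) \<and>
     (\<forall>x\<in>S. \<forall>y\<in>S. \<forall>z\<in>S. m (m x y) z = m x (m y z))"

definition idempotents :: "'b set \<Rightarrow> ('b \<Rightarrow> 'b \<Rightarrow> 'b) \<Rightarrow> 'b set" where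
  "idempotents S m = {e \<in> S. m e e = e}"

definition is_band :: "'b set \<Rightarrow> ('b \<Rightarrow> 'b \<Rightarrow> 'b) \<Rightarrow> bool" where
  "is_band S m \<longleftrightarrow> is_semigroup S m \<and> (\<forall>e\<in>S. m e e = e)"

text \<open>
  The congruence on the free monoid of words over \<open>X\<close> generated by the pairs in \<open>R\<close>. If \<open>R\<close> only
  relates nonempty words, its restriction to nonempty words is the congruence generated
  by \<open>R\<close> on the free semigroup over \<open>X\<close>, the empty word being related only to itself.
\<close>

inductive_set word_cong :: "'x set \<Rightarrow> ('x list \<times> 'x list) set \<Rightarrow> ('x list \<times> 'x list) set"
  for X :: "'x set" and R :: "('x list \<times> 'x list) set" where
  rel: "\<lbrakk>(u, v) \<in> R; u \<in> lists X; v \<in> lists X; p \<in> lists X; q \<in> lists X\<rbrakk>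
        \<Longrightarrow> (p @ u @ q, p @ v @ q) \<in> word_cong X R"
| refl: "w \<in> lists X \<Longrightarrow> (w, w) \<in> word_cong X R"
| sym: "(u, v) \<in> word_cong X R \<Longrightarrow> (v, u) \<in> word_cong X R"
| trans: "\<lbrakk>(u, v) \<in> word_cong X R; (v, w) \<in> word_cong X R\<rbrakk> \<Longrightarrow> (u, w) \<in> word_cong X R"

definition class_mult :: "('x list \<times> 'x list) set \<Rightarrow> 'x list set \<Rightarrow> 'x list set \<Rightarrow> 'x list set" where
  "class_mult r A B = (\<Union>a\<in>A. \<Union>b\<in>B. r `` {a @ b})"

lemma word_cong_in_lists:
  assumes "(u, v) \<in> word_cong X R"
  shows "u \<in> lists X" "v \<in> lists X"
  using assms by (induction) auto

lemma equiv_word_cong: "equiv (lists X) (word_cong X R)"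
proof (rule equivI)
  show "word_cong X R \<subseteq> lists X \<times> lists X"
    using word_cong_in_lists by fast
  show "refl_on (lists X) (word_cong X R)"
    by (auto simp: refl_on_def intro: word_cong.refl)
  show "Relation.sym (word_cong X R)"
    by (rule symI) (rule word_cong.sym)
  show "Relation.trans (word_cong X R)"
    by (rule transI) (rule word_cong.trans)
qed

lemma word_cong_context:
  assumes "(u, v) \<in> word_cong X R" "p \<in> lists X" "q \<in> lists X"
  shows "(p @ u @ q, p @ v @ q) \<in> word_cong X R"
  using assms
proof (induction)
  case (rel u v p' q')
  then have "((p @ p') @ u @ (q' @ q), (p @ p') @ v @ (q' @ q)) \<in> word_cong X R"
    by (intro word_cong.rel) auto
  then show ?case by simp
next
  case (refl w)
  then show ?case by (intro word_cong.refl) auto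
next
  case (sym u v)
  then show ?case by (blast intro: word_cong.sym)
next
  case (trans u v w)
  then show ?case by (blast intro: word_cong.trans)
qed

lemma word_cong_append:
  assumes "(u, v) \<in> word_cong X R" "(u', v') \<in> word_cong X R"
  shows "(u @ u', v @ v') \<in> word_cong X R"
proof -
  have "(u @ u', v @ u') \<in> word_cong X R"
    using word_cong_context[OF assms(1), of "[]" u'] word_cong_in_lists[OF assms(2)] by simp
  moreover have "(v @ u', v @ v') \<in> word_cong X R"
    using word_cong_context[OF assms(2), of v "[]"] word_cong_in_lists[OF assms(1)] by simp
  ultimately show ?thesis by (rule word_cong.trans)
qed

lemma class_mult_classes:
  assumes "u \<in> lists X" "v \<in> lists X"
  shows "class_mult (word_cong X R) (word_cong X R `` {u}) (word_cong X R `` {v})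
         = word_cong X R `` {u @ v}"
proof -
  let ?r = "word_cong X R"
  have "?r `` {a @ b} = ?r `` {u @ v}" if "(u, a) \<in> ?r" "(v, b) \<in> ?r" for a b
    using equiv_class_eq[OF equiv_word_cong word_cong_append[OF that]] by simp
  moreover have "(u, u) \<in> ?r" "(v, v) \<in> ?r"
    using assms by (auto intro: word_cong.refl)
  ultimately show ?thesis
    unfolding class_mult_def by blast
qed

definition basic_pair :: "('b \<Rightarrow> 'b \<Rightarrow> 'b) \<Rightarrow> 'b \<Rightarrow> 'b \<Rightarrow> bool" where
  "basic_pair m e f \<longleftrightarrow> {m e f, m f e} \<inter> {e, f} \<noteq> {}"

definition IG_rels :: "'b set \<Rightarrow> ('b \<Rightarrow> 'b \<Rightarrow> 'b) \<Rightarrow> ('b list \<times> 'b list) set" where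
  "IG_rels S m = {([e, f], [m e f]) | e f.
     e \<in> idempotents S m \<and> f \<in> idempotents S m \<and> basic_pair m e f}"

definition IG_cong :: "'b set \<Rightarrow> ('b \<Rightarrow> 'b \<Rightarrow> 'b) \<Rightarrow> ('b list \<times> 'b list) set" where
  "IG_cong S m = word_cong (idempotents S m) (IG_rels S m)"

definition IG_carrier :: "'b set \<Rightarrow> ('b \<Rightarrow> 'b \<Rightarrow> 'b) \<Rightarrow> 'b list set set" where
  "IG_carrier S m = (lists (idempotents S m) - {[]}) // IG_cong S m"

definition IG_mult :: "'b set \<Rightarrow> ('b \<Rightarrow> 'b \<Rightarrow> 'b) \<Rightarrow> 'b list set \<Rightarrow> 'b list set \<Rightarrow> 'b list set" where
  "IG_mult S m = class_mult (IG_cong S m)"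

lemma is_semigroup_IG: "is_semigroup (IG_carrier S m) (IG_mult S m)"
  unfolding is_semigroup_def
proof (intro conjI ballI)
  let ?W = "lists (idempotents S m) - {[]}"
  have mult: "IG_mult S m (IG_cong S m `` {u}) (IG_cong S m `` {v}) = IG_cong S m `` {u @ v}"
    if "u \<in> ?W" "v \<in> ?W" for u v
    using that class_mult_classes[of u "idempotents S m" v] unfolding IG_mult_def IG_cong_def by simp
  fix x y
  assume "x \<in> IG_carrier S m" "y \<in> IG_carrier S m"
  then obtain u v where u: "u \<in> ?W" "x = IG_cong S m `` {u}"
    and v: "v \<in> ?W" "y = IG_cong S m `` {v}"
    unfolding IG_carrier_def by (auto elim!: quotientE)
  have uv: "u @ v \<in> ?W" using u v by auto
  then show "IG_mult S m x y \<in> IG_carrier S m"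
    using mult[OF u(1) v(1)] u(2) v(2) by (simp add: IG_carrier_def quotientI)
  fix z
  assume "z \<in> IG_carrier S m"
  then obtain w where w: "w \<in> ?W" "z = IG_cong S m `` {w}"
    unfolding IG_carrier_def by (auto elim!: quotientE)
  have vw: "v @ w \<in> ?W" using v w by auto
  show "IG_mult S m (IG_mult S m x y) z = IG_mult S m x (IG_mult S m y z)"
    unfolding u(2) v(2) w(2) mult[OF u(1) v(1)] mult[OF v(1) w(1)] mult[OF uv w(1)]
      mult[OF u(1) vw] by simp
qed

definition group_on :: "'t set \<Rightarrow> ('t \<Rightarrow> 't \<Rightarrow> 't) \<Rightarrow> 't \<Rightarrow> 't monoid" where
  "group_on H m e = \<lparr>carrier = H, mult = m, one = e\<rparr>"

definition subgroup_of_semigroup ::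
  "'t set \<Rightarrow> ('t \<Rightarrow> 't \<Rightarrow> 't) \<Rightarrow> 't set \<Rightarrow> 't \<Rightarrow> bool" where
  "subgroup_of_semigroup T m H e \<longleftrightarrow> H \<subseteq> T \<and> group (group_on H m e)"

definition maximal_subgroup ::
  "'t set \<Rightarrow> ('t \<Rightarrow> 't \<Rightarrow> 't) \<Rightarrow> 't set \<Rightarrow> 't \<Rightarrow> bool" where
  "maximal_subgroup T m H e \<longleftrightarrow>
     subgroup_of_semigroup T m H e \<and>
     (\<forall>H' e'. subgroup_of_semigroup T m H' e' \<and> H \<subseteq> H' \<longrightarrow> H' = H)"

definition IG_has_maximal_subgroup_iso ::
  "'b set \<Rightarrow> ('b \<Rightarrow> 'b \<Rightarrow> 'b) \<Rightarrow> ('a, 'm) monoid_scheme \<Rightarrow> bool" where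
  "IG_has_maximal_subgroup_iso S m G \<longleftrightarrow>
     (\<exists>H e. maximal_subgroup (IG_carrier S m) (IG_mult S m) H e \<and>
            G \<cong> group_on H (IG_mult S m) e)"

text \<open>
  A letter \<open>(x, True)\<close> stands for the generator \<open>x\<close> and \<open>(x, False)\<close> for its formal inverse.
\<close>

definition free_group_cong ::
  "'x set \<Rightarrow> (('x \<times> bool) list \<times> ('x \<times> bool) list) set" where
  "free_group_cong X = word_cong (X \<times> UNIV) {([(x, b), (x, \<not> b)], []) | x b. x \<in> X}"

definition free_group :: "'x set \<Rightarrow> ('x \<times> bool) list set monoid" where
  "free_group X =
     \<lparr>carrier = lists (X \<times> UNIV) // free_group_cong X,
      mult = class_mult (free_group_cong X),
      one = free_group_cong X `` {[]}\<rparr>"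

lemma group_free_group: "group (free_group X)"
proof -
  let ?W = "lists (X \<times> (UNIV :: bool set))" and ?r = "free_group_cong X"
  let ?inv = "\<lambda>w. rev (map (\<lambda>(x, b). (x, \<not> b)) w)"
  have mult: "class_mult ?r (?r `` {u}) (?r `` {v}) = ?r `` {u @ v}"
    if "u \<in> ?W" "v \<in> ?W" for u v
    using that unfolding free_group_cong_def by (rule class_mult_classes)
  have inv_W: "?inv w \<in> ?W" if "w \<in> ?W" for w
    using that by (auto simp: lists_eq_set)
  have inv_cong: "(?inv w @ w, []) \<in> ?r" if "w \<in> ?W" for w
    using that
  proof (induction w)
    case Nil
    show ?case by (auto simp: free_group_cong_def intro: word_cong.refl)
  next
    case (Cons a w)
    obtain x b where a: "a = (x, b)" by (cases a)
    have w: "w \<in> ?W" and x: "x \<in> X" using Cons.hyps a by auto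
    have "(?inv w @ [(x, \<not> b), (x, \<not> \<not> b)] @ w, ?inv w @ [] @ w) \<in> ?r"
      unfolding free_group_cong_def using x w inv_W[OF w]
      by (intro word_cong.rel) auto
    then have "(?inv (a # w) @ a # w, ?inv w @ w) \<in> ?r"
      by (simp add: a)
    then show ?case
      using Cons.IH unfolding free_group_cong_def by (rule word_cong.trans)
  qed
  show ?thesis
  proof (rule groupI)
    fix A B assume A: "A \<in> carrier (free_group X)" and B: "B \<in> carrier (free_group X)"
    from A obtain u where u: "u \<in> ?W" "A = ?r `` {u}"
      by (auto simp: free_group_def elim!: quotientE)
    from B obtain v where v: "v \<in> ?W" "B = ?r `` {v}"
      by (auto simp: free_group_def elim!: quotientE)
    have uv: "u @ v \<in> ?W" using u v by auto
    then show "A \<otimes>\<^bsub>free_group X\<^esub> B \<in> carrier (free_group X)"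
      by (simp add: free_group_def u(2) v(2) mult[OF u(1) v(1)] quotientI)
    fix C assume "C \<in> carrier (free_group X)"
    then obtain w where w: "w \<in> ?W" "C = ?r `` {w}"
      by (auto simp: free_group_def elim!: quotientE)
    have vw: "v @ w \<in> ?W" using v w by auto
    show "A \<otimes>\<^bsub>free_group X\<^esub> B \<otimes>\<^bsub>free_group X\<^esub> C
        = A \<otimes>\<^bsub>free_group X\<^esub> (B \<otimes>\<^bsub>free_group X\<^esub> C)"
      by (simp add: free_group_def u(2) v(2) w(2) mult[OF u(1) v(1)] mult[OF v(1) w(1)]
          mult[OF uv w(1)] mult[OF u(1) vw])
  next
    show "\<one>\<^bsub>free_group X\<^esub> \<in> carrier (free_group X)"
      by (simp add: free_group_def quotientI)
  next
    fix A assume "A \<in> carrier (free_group X)"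
    then obtain u where u: "u \<in> ?W" "A = ?r `` {u}"
      by (auto simp: free_group_def elim!: quotientE)
    show "\<one>\<^bsub>free_group X\<^esub> \<otimes>\<^bsub>free_group X\<^esub> A = A"
      using mult[OF _ u(1), of "[]"] by (simp add: free_group_def u(2))
    have "?r `` {?inv u @ u} = ?r `` {[]}"
      by (rule equiv_class_eq[OF equiv_word_cong inv_cong[OF u(1), unfolded free_group_cong_def],
            folded free_group_cong_def])
    then have "?r `` {?inv u} \<otimes>\<^bsub>free_group X\<^esub> A = \<one>\<^bsub>free_group X\<^esub>"
      by (simp add: free_group_def u(2) mult[OF inv_W[OF u(1)] u(1)])
    moreover have "?r `` {?inv u} \<in> carrier (free_group X)"
      using inv_W[OF u(1)] by (simp add: free_group_def quotientI)
    ultimately show "\<exists>C\<in>carrier (free_group X). C \<otimes>\<^bsub>free_group X\<^esub> A = \<one>\<^bsub>free_group X\<^esub>"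
      by blast
  qed
qed

definition normal_closure :: "('a, 'm) monoid_scheme \<Rightarrow> 'a set \<Rightarrow> 'a set" where
  "normal_closure F R = \<Inter>{N. N \<lhd> F \<and> R \<subseteq> N}"

text \<open>A finite set of generators may always be taken to be a set of natural numbers.\<close>

definition finitely_presented :: "('a, 'm) monoid_scheme \<Rightarrow> bool" where
  "finitely_presented G \<longleftrightarrow>
     (\<exists>(X :: nat set) R. finite X \<and> finite R \<and> R \<subseteq> carrier (free_group X) \<and>
        G \<cong> free_group X Mod normal_closure (free_group X) R)"

end

theory Submission
  imports Defs "HOL-Algebra.Generated_Groups"
begin

text \<open>
  Choose \<open>A \<subseteq> G\<close> containing \<open>1\<close> such that \<open>G\<close> is presented by the generators \<open>A\<close> and those
  relations \<open>a b = c\<close> that hold among elements of \<open>A\<close>: all of \<open>G\<close> in general, and for finitely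
  presented \<open>G\<close> the finite set of values of words of length at most \<open>n\<close>, where \<open>n\<close> bounds the lengths of the relators. The band
  is a rectangular band \<open>I \<times> J\<close> together with a left zero band of four elements. Here
  \<open>I = {x\<^sub>0, x\<^sub>1, y\<^sub>0, y\<^sub>1}\<close>, and \<open>J\<close> consists of a row for every \<open>a \<in> A\<close> and
  a row for every relation. With the matrix \<open>p\<close> whose rows are \<open>(1, 1, a, a)\<close> and
  \<open>(1, a, ab, a)\<close> respectively, the semigroup \<open>IG\<close> of the band acts on \<open>G \<times> J\<close> by
  \<open>(g, j) (i, l) = (g p\<^bsub>ji\<^esub> p\<^bsub>li\<^esub>\<inverse>, l)\<close>. Conversely the
  elements \<open>q\<^bsub>ji\<^esub> = (x\<^sub>0, j) (i, 1)\<close> of \<open>IG\<close> are units of the local monoid of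
  \<open>\<epsilon> = (x\<^sub>0, 1)\<close>, and the singular squares of the four extra elements are exactly the
  relations which make \<open>p\<^bsub>ji\<^esub> \<mapsto> q\<^bsub>ji\<^esub>\<close> extend to a homomorphism on \<open>G\<close>. It is
  onto \<open>\<epsilon> IG \<epsilon>\<close> because every element of \<open>IG\<close> moves \<open>\<psi>(g) (x\<^sub>0, j)\<close> as it moves
  \<open>(g, j)\<close>, and the action inverts it.
\<close>

section \<open>The band\<close>

datatype 'a row = Gen 'a | Rel 'a 'a

text \<open>The column \<open>x\<^sub>k\<close> is \<open>(False, k)\<close> and \<open>y\<^sub>k\<close> is \<open>(True, k)\<close>.\<close>

datatype 'a elt = Rect "bool \<times> bool" "'a row" | Ext bool bool

definition rows :: "('a, 'm) monoid_scheme \<Rightarrow> 'a set \<Rightarrow> 'a row set" where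
  "rows G A = Gen ` A \<union> {Rel a b | a b. a \<in> A \<and> b \<in> A \<and> a \<otimes>\<^bsub>G\<^esub> b \<in> A}"

fun proj :: "bool \<Rightarrow> bool \<Rightarrow> bool \<times> bool \<Rightarrow> bool \<times> bool" where
  "proj s t (c, k) = (c, if c then t else s)"

text \<open>
  The quotient of the entries of a row in the columns \<open>x\<^sub>s\<close> and \<open>y\<^sub>t\<close>. It determines the row
  to which \<open>Ext s t\<close> maps the given one, and it is an element of \<open>A\<close> for all \<open>s\<close> and \<open>t\<close>.
\<close>

fun quot :: "('a, 'm) monoid_scheme \<Rightarrow> bool \<Rightarrow> bool \<Rightarrow> 'a row \<Rightarrow> 'a" where
  "quot G s t (Gen a) = a"
| "quot G s t (Rel a b) =
     (if s then if t then \<one>\<^bsub>G\<^esub> else b else if t then a else a \<otimes>\<^bsub>G\<^esub> b)"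

fun entry :: "('a, 'm) monoid_scheme \<Rightarrow> 'a row \<Rightarrow> bool \<times> bool \<Rightarrow> 'a" where
  "entry G (Gen a) (c, k) = (if c then a else \<one>\<^bsub>G\<^esub>)"
| "entry G (Rel a b) (c, k) =
     (if c then if k then a else a \<otimes>\<^bsub>G\<^esub> b else if k then a else \<one>\<^bsub>G\<^esub>)"

fun band_mult :: "('a, 'm) monoid_scheme \<Rightarrow> 'a elt \<Rightarrow> 'a elt \<Rightarrow> 'a elt" where
  "band_mult G (Rect i j) (Rect k l) = Rect i l"
| "band_mult G (Rect i j) (Ext s t) = Rect i (Gen (quot G s t j))"
| "band_mult G (Ext s t) (Rect i j) = Rect (proj s t i) j"
| "band_mult G (Ext s t) (Ext s' t') = Ext s t"

definition band_carrier :: "('a, 'm) monoid_scheme \<Rightarrow> 'a set \<Rightarrow> 'a elt set" where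
  "band_carrier G A = {Rect i j | i j. j \<in> rows G A} \<union> {Ext s t | s t. True}"

text \<open>A letter \<open>Ext s t\<close> moves \<open>(g, j)\<close> as
  \<open>Rect (False, s) (Gen (quot G s t j))\<close> does, because \<open>Gen\<close> rows have
  entry one in both x columns.\<close>

fun act :: "('a, 'm) monoid_scheme \<Rightarrow> 'a \<times> 'a row \<Rightarrow> 'a elt \<Rightarrow> 'a \<times> 'a row" where
  "act G (g, j) (Rect i l) = (g \<otimes>\<^bsub>G\<^esub> entry G j i \<otimes>\<^bsub>G\<^esub> inv\<^bsub>G\<^esub> entry G l i, l)"
| "act G (g, j) (Ext s t) = (g \<otimes>\<^bsub>G\<^esub> entry G j (False, s), Gen (quot G s t j))"

section \<open>Generators with the triangular relations that hold among them\<close>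

text \<open>The existence half of the universal property of the presentation by A and its triangular
  relations; uniqueness comes from generation. A formula cannot range over all types, so the type of
  the target groups is a parameter, later that of the elements of IG.\<close>

definition partial_homs_extend :: "'t itself \<Rightarrow> ('a, 'm) monoid_scheme \<Rightarrow> 'a set \<Rightarrow> bool" where
  "partial_homs_extend (_ :: 't itself) G A \<longleftrightarrow>
     (\<forall>(H :: 't monoid) \<theta>. group H \<and> \<theta> \<in> A \<rightarrow> carrier H \<and>
        (\<forall>a\<in>A. \<forall>b\<in>A. a \<otimes>\<^bsub>G\<^esub> b \<in> A \<longrightarrow> \<theta> (a \<otimes>\<^bsub>G\<^esub> b) = \<theta> a \<otimes>\<^bsub>H\<^esub> \<theta> b)
        \<longrightarrow> (\<exists>\<psi>\<in>hom G H. \<forall>a\<in>A. \<psi> a = \<theta> a))"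

locale partial_group = group G for G (structure) +
  fixes A :: "'a set"
  assumes subset: "A \<subseteq> carrier G"
    and one_in: "\<one> \<in> A"
    and generates: "generate G A = carrier G"
begin

declare one_in [simp]

abbreviation "J \<equiv> rows G A"

lemma A_carrier [simp]: "a \<in> A \<Longrightarrow> a \<in> carrier G"
  using subset by blast

lemma entry_closed [simp]: "j \<in> J \<Longrightarrow> entry G j i \<in> carrier G"
  using subset by (cases i) (auto simp: rows_def)

lemma quot_closed [simp]: "j \<in> J \<Longrightarrow> quot G s t j \<in> A"
  using one_in by (auto simp: rows_def)

lemma Gen_in_rows [simp]: "Gen a \<in> J \<longleftrightarrow> a \<in> A"
  by (auto simp: rows_def)

lemma entry_quot: "j \<in> J \<Longrightarrow> entry G j (False, s) \<otimes> quot G s t j = entry G j (True, t)"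
  by (auto simp: rows_def)

lemma Rect_in_band [simp]: "Rect i j \<in> band_carrier G A \<longleftrightarrow> j \<in> J"
  and Ext_in_band [simp]: "Ext s t \<in> band_carrier G A"
  by (auto simp: band_carrier_def)

lemma band_cases:
  assumes "x \<in> band_carrier G A"
  obtains i j where "x = Rect i j" "j \<in> J" | s t where "x = Ext s t"
  using assms by (auto simp: band_carrier_def)

lemma proj_proj [simp]: "proj s t (proj s' t' i) = proj s t i"
  by (cases i) auto

lemma band_mult_closed:
  "x \<in> band_carrier G A \<Longrightarrow> y \<in> band_carrier G A \<Longrightarrow> band_mult G x y \<in> band_carrier G A"
  by (auto elim!: band_cases)

lemma band_mult_assoc:
  "band_mult G (band_mult G x y) z = band_mult G x (band_mult G y z)"
  by (cases x; cases y; cases z) auto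

lemma band_mult_idem: "band_mult G x x = x"
  by (cases x) auto

lemma act_closed:
  "s \<in> carrier G \<times> J \<Longrightarrow> x \<in> band_carrier G A \<Longrightarrow> act G s x \<in> carrier G \<times> J"
  by (auto elim!: band_cases)

lemma inv_mult_cancel:
  "x \<in> carrier G \<Longrightarrow> y \<in> carrier G \<Longrightarrow> inv x \<otimes> (x \<otimes> y) = y"
  by (simp flip: m_assoc)

text \<open>These equations let the action of letters descend to IG. Two \<open>Rect\<close>
  elements form a basic pair only in a common row or column, where entries cancel; a
  \<open>Rect\<close> and an \<open>Ext\<close> do so only if the \<open>Ext\<close> fixes the
  column or the row.\<close>

lemma act_basic_pair:
  assumes s: "s \<in> carrier G \<times> J" and xy: "x \<in> band_carrier G A" "y \<in> band_carrier G A"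
    and bp: "basic_pair (band_mult G) x y"
  shows "act G (act G s x) y = act G s (band_mult G x y)"
proof -
  obtain g j where gj: "s = (g, j)" "g \<in> carrier G" "j \<in> J"
    using s by auto
  show ?thesis
  proof (cases x; cases y)
    fix i j' k l assume [simp]: "x = Rect i j'" "y = Rect k l"
    have "j' = l \<or> i = k" using bp by (auto simp: basic_pair_def)
    then show ?thesis
      using gj xy by (auto simp: m_assoc inv_mult_cancel)
  next
    fix i j' u v assume [simp]: "x = Rect i j'" "y = Ext u v"
    obtain c k where [simp]: "i = (c, k)" by (cases i)
    have j': "j' \<in> J" using xy by simp
    have "entry G j' (False, u) = entry G j' i \<otimes> inv entry G (Gen (quot G u v j')) i"
    proof (cases "proj u v i = i")
      case True
      then show ?thesis
        using j' entry_quot[OF j', of u v] entry_closed[OF j'] quot_closed[OF j', of u v] subset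
        by (cases c) (auto simp: inv_solve_right subset_iff)
    next
      case False
      \<comment> \<open>When the column moves, the row is fixed, hence of the form
        \<open>Gen a\<close>, and the two factors on the right cancel.\<close>
      then have "Gen (quot G u v j') = j'" using bp by (auto simp: basic_pair_def)
      then obtain a where "j' = Gen a" "a \<in> A" using j' by (cases j') auto
      then show ?thesis using subset by auto
    qed
    then show ?thesis
      using gj j' by (cases c) (auto simp: m_assoc inv_mult_cancel)
  next
    fix i l u v assume [simp]: "y = Rect i l" "x = Ext u v"
    obtain c k where [simp]: "i = (c, k)" by (cases i)
    have l: "l \<in> J" using xy by simp
    have "entry G j (False, u) \<otimes> entry G (Gen (quot G u v j)) i \<otimes> inv entry G l i
       = entry G j (proj u v i) \<otimes> inv entry G l (proj u v i)"
    proof -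
      have 1: "entry G j (False, u) \<otimes> entry G (Gen (quot G u v j)) i = entry G j (proj u v i)"
        using entry_quot[OF gj(3)] gj(3) by (cases c) auto
      \<comment> \<open>The entries of a row \<open>Gen a\<close> depend only on the kind of column,
        x or y, which \<open>proj\<close> preserves.\<close>
      have "proj u v i = i \<or> (\<exists>a. l = Gen a)"
        using bp l by (auto simp: basic_pair_def)
      then have "entry G l i = entry G l (proj u v i)"
        by auto
      with 1 show ?thesis by simp
    qed
    then show ?thesis
      using gj l subset by (auto simp: m_assoc)
  next
    fix u v u' v' assume [simp]: "x = Ext u v" "y = Ext u' v'"
    show ?thesis using gj subset by auto
  qed
qed

end

section \<open>Local monoids and maximal subgroups\<close>

locale semigroup_on =
  fixes T :: "'t set" and mul :: "'t \<Rightarrow> 't \<Rightarrow> 't" (infixl "\<cdot>" 70)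
  assumes closed [simp]: "x \<in> T \<Longrightarrow> y \<in> T \<Longrightarrow> x \<cdot> y \<in> T"
    and assoc: "x \<in> T \<Longrightarrow> y \<in> T \<Longrightarrow> z \<in> T \<Longrightarrow> x \<cdot> y \<cdot> z = x \<cdot> (y \<cdot> z)"
begin

definition corner :: "'t \<Rightarrow> 't set" where
  "corner e = {x \<in> T. e \<cdot> x = x \<and> x \<cdot> e = x}"

lemma monoid_corner:
  assumes "e \<in> T" "e \<cdot> e = e"
  shows "monoid (group_on (corner e) (\<cdot>) e)"
proof (rule monoidI)
  fix x y z
  assume "x \<in> carrier (group_on (corner e) (\<cdot>) e)" "y \<in> carrier (group_on (corner e) (\<cdot>) e)"
  then have xy: "x \<in> T" "y \<in> T" "e \<cdot> x = x" "y \<cdot> e = y"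
    by (auto simp: group_on_def corner_def)
  then have "e \<cdot> (x \<cdot> y) = x \<cdot> y" "(x \<cdot> y) \<cdot> e = x \<cdot> y"
    using assms by (simp_all add: assoc flip: assoc[of e])
  with xy show "x \<otimes>\<^bsub>group_on (corner e) (\<cdot>) e\<^esub> y \<in> carrier (group_on (corner e) (\<cdot>) e)"
    by (simp add: group_on_def corner_def)
qed (use assms in \<open>auto simp: group_on_def corner_def assoc\<close>)

text \<open>A subgroup containing the idempotent e has e as its identity, so all its elements lie in
  eTe.\<close>

lemma maximal_subgroup_corner:
  assumes e: "e \<in> T" "e \<cdot> e = e" and grp: "group (group_on (corner e) (\<cdot>) e)"
  shows "maximal_subgroup T (\<cdot>) (corner e) e"
  unfolding maximal_subgroup_def subgroup_of_semigroup_def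
proof (intro conjI allI impI)
  show "corner e \<subseteq> T" by (auto simp: corner_def)
  fix H' e'
  assume *: "(H' \<subseteq> T \<and> group (group_on H' (\<cdot>) e')) \<and> corner e \<subseteq> H'"
  then interpret H': group "group_on H' (\<cdot>) e'" by simp
  have "e \<in> H'" using * e by (auto simp: corner_def)
  then have "e = e'"
    using H'.one_unique H'.l_cancel_one'[of e e] e by (simp add: group_on_def)
  then have "x \<in> corner e" if "x \<in> H'" for x
    using H'.l_one[of x] H'.r_one[of x] that * by (auto simp: group_on_def corner_def)
  with * show "H' = corner e" by blast
qed (rule grp)

end

section \<open>The maximal subgroup\<close>

text \<open>Collects what the argument uses of IG: generation by the band, the relations of basic
  pairs, and the right action on states. Words and congruence classes enter only in the
  instantiation.\<close>

locale band_representation =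
  partial_group G A + semigroup_on T mul
  for G (structure) and A :: "'a set" and T :: "'t set" and mul (infixl "\<cdot>" 70) +
  fixes \<rho> :: "'a elt \<Rightarrow> 't" and \<Phi> :: "'t \<Rightarrow> 'a \<times> 'a row \<Rightarrow> 'a \<times> 'a row"
  assumes rho_closed [simp]: "x \<in> band_carrier G A \<Longrightarrow> \<rho> x \<in> T"
    and rho_mult: "\<lbrakk>x \<in> band_carrier G A; y \<in> band_carrier G A; basic_pair (band_mult G) x y\<rbrakk>
      \<Longrightarrow> \<rho> x \<cdot> \<rho> y = \<rho> (band_mult G x y)"
    and rho_induct [consumes 1, case_names rep mult]: "\<lbrakk>u \<in> T; \<And>x. x \<in> band_carrier G A \<Longrightarrow> P (\<rho> x);
      \<And>u v. u \<in> T \<Longrightarrow> v \<in> T \<Longrightarrow> P u \<Longrightarrow> P v \<Longrightarrow> P (u \<cdot> v)\<rbrakk> \<Longrightarrow> P u"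
    and Phi_rho: "\<lbrakk>x \<in> band_carrier G A; s \<in> carrier G \<times> J\<rbrakk> \<Longrightarrow> \<Phi> (\<rho> x) s = act G s x"
    and Phi_closed: "\<lbrakk>u \<in> T; s \<in> carrier G \<times> J\<rbrakk> \<Longrightarrow> \<Phi> u s \<in> carrier G \<times> J"
    and Phi_mult: "\<lbrakk>u \<in> T; v \<in> T; s \<in> carrier G \<times> J\<rbrakk> \<Longrightarrow> \<Phi> (u \<cdot> v) s = \<Phi> v (\<Phi> u s)"
    and extension: "partial_homs_extend TYPE('t) G A"
begin

abbreviation "r i j \<equiv> \<rho> (Rect i j)"
abbreviation "e s t \<equiv> \<rho> (Ext s t)"
definition "\<epsilon> = r (False, False) (Gen \<one>)"
definition "q j i = r (False, False) j \<cdot> r i (Gen \<one>)"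


section \<open>Products of generators of IG\<close>

lemma same_row: "j \<in> J \<Longrightarrow> r i j \<cdot> r k j = r i j"
  by (subst rho_mult) (auto simp: basic_pair_def)

lemma same_col: "j \<in> J \<Longrightarrow> l \<in> J \<Longrightarrow> r i j \<cdot> r i l = r i l"
  by (subst rho_mult) (auto simp: basic_pair_def)

lemma r_e: "j \<in> J \<Longrightarrow> proj s t i = i \<Longrightarrow> r i j \<cdot> e s t = r i (Gen (quot G s t j))"
  by (subst rho_mult) (auto simp: basic_pair_def)

lemma e_r: "a \<in> A \<Longrightarrow> e s t \<cdot> r i (Gen a) = r (proj s t i) (Gen a)"
  by (subst rho_mult) (auto simp: basic_pair_def)

text \<open>Two factors in the common column k multiply by \<open>same_col\<close>, and
  \<open>e k' k'\<close> moves column k to k'. So columns of one kind are interchangeable as long as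
  only \<open>Gen\<close> rows occur.\<close>

lemma slide:
  assumes "a \<in> A" "b \<in> A"
  shows "r (c, k') (Gen a) \<cdot> r (c, k) (Gen b) = r (c, k') (Gen b)"
proof -
  have "r (c, k') (Gen a) \<cdot> r (c, k) (Gen b) = e k' k' \<cdot> r (c, k) (Gen a) \<cdot> r (c, k) (Gen b)"
    using assms by (simp add: e_r)
  also have "\<dots> = e k' k' \<cdot> (r (c, k) (Gen a) \<cdot> r (c, k) (Gen b))"
    using assms by (simp add: assoc)
  also have "\<dots> = r (c, k') (Gen b)"
    using assms by (simp add: same_col e_r)
  finally show ?thesis .
qed

text \<open>The factor \<open>r k j\<close>, inserted by \<open>same_row\<close>, places
  \<open>e s t\<close> next to a column that it fixes. Both x_s and y_t qualify as k; comparing the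
  two choices gives the relation of a singular square.\<close>

lemma r_e_any:
  assumes j: "j \<in> J" and k: "proj s t k = k"
  shows "r i j \<cdot> e s t = r i j \<cdot> r k (Gen (quot G s t j))"
proof -
  have "r i j \<cdot> e s t = r i j \<cdot> r k j \<cdot> e s t"
    using j by (simp add: same_row)
  also have "\<dots> = r i j \<cdot> (r k j \<cdot> e s t)"
    using j by (simp add: assoc)
  finally show ?thesis using assms by (simp add: r_e)
qed

lemma q_closed [simp]: "j \<in> J \<Longrightarrow> q j i \<in> T"
  by (simp add: q_def)

lemma eps_closed [simp]: "\<epsilon> \<in> T"
  by (simp add: \<epsilon>_def)

lemma eps_idem: "\<epsilon> \<cdot> \<epsilon> = \<epsilon>"
  by (simp add: \<epsilon>_def same_row)

lemma q_first_col: "j \<in> J \<Longrightarrow> q j (False, False) = \<epsilon>"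
  by (simp add: q_def \<epsilon>_def same_col)

lemma q_first_row: "q (Gen \<one>) i = \<epsilon>"
  by (simp add: q_def \<epsilon>_def same_row)

lemma q_Gen_True:
  assumes "a \<in> A" shows "q (Gen a) (True, k) = q (Gen a) (True, False)"
proof -
  let ?i = "(False, False)"
  have "q (Gen a) (True, k) = r ?i (Gen a) \<cdot> r (True, False) (Gen a) \<cdot> r (True, k) (Gen \<one>)"
    using assms by (simp add: q_def same_row)
  also have "\<dots> = r ?i (Gen a) \<cdot> (r (True, False) (Gen a) \<cdot> r (True, k) (Gen \<one>))"
    using assms by (simp add: assoc)
  also have "\<dots> = q (Gen a) (True, False)"
    using assms by (simp add: q_def slide)
  finally show ?thesis .
qed

text \<open>The counterpart of \<open>entry_quot\<close> in IG: a singular square trades column y_t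
  for x_s, after which \<open>slide\<close> splits the product into two values of q.\<close>

lemma q_quot:
  assumes j: "j \<in> J"
  shows "q j (True, t) = q j (False, s) \<cdot> q (Gen (quot G s t j)) (True, False)"
proof -
  let ?i = "(False, False)" and ?c = "Gen (quot G s t j)" and ?e = "Gen \<one>"
  have c: "quot G s t j \<in> A" using j by simp
  have "q j (True, t) = r ?i j \<cdot> (r (True, t) ?c \<cdot> r (True, t) ?e)"
    using j by (simp add: q_def same_col)
  also have "\<dots> = r ?i j \<cdot> r (True, t) ?c \<cdot> r (True, t) ?e"
    using j by (simp add: assoc)
  \<comment> \<open>Both sides equal the product of \<open>r ?i j\<close> and \<open>e s t\<close>,
    whose fixed columns are y_t and x_s.\<close>
  also have "r ?i j \<cdot> r (True, t) ?c = r ?i j \<cdot> r (False, s) ?c"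
    using r_e_any[OF j, of s t "(True, t)" ?i] r_e_any[OF j, of s t "(False, s)" ?i] by simp
  also have "r (False, s) ?c = r (False, s) ?e \<cdot> (r ?i ?e \<cdot> r ?i ?c)"
    using j by (simp add: same_col slide)
  also have "\<dots> = r (False, s) ?e \<cdot> r ?i ?e \<cdot> r ?i ?c"
    using j by (simp add: assoc)
  also have "\<dots> = r (False, s) ?e \<cdot> r ?i ?c"
    by (simp add: same_row)
  finally have "q j (True, t) = q j (False, s) \<cdot> q ?c (True, t)"
    using j by (simp add: q_def assoc)
  then show ?thesis using q_Gen_True[OF c, of t] by simp
qed

section \<open>The units q of the local monoid at \<epsilon>\<close>

abbreviation "M \<equiv> group_on (corner \<epsilon>) (\<cdot>) \<epsilon>"

lemma M_simps [simp]: "carrier M = corner \<epsilon>" "mult M = (\<cdot>)" "one M = \<epsilon>"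
  by (simp_all add: group_on_def)

sublocale M: monoid M
  using monoid_corner[OF eps_closed eps_idem] .

lemma q_Unit:
  assumes j: "j \<in> J" shows "q j i \<in> Units M"
proof -
  let ?i = "(False, False)" and ?e = "Gen \<one>"
  \<comment> \<open>The inverse of \<open>q j i\<close> is \<open>r i j\<close> multiplied by
    \<epsilon> on both sides; the two products collapse by moves along rows and columns.\<close>
  define p where "p = r ?i ?e \<cdot> (r i j \<cdot> r ?i ?e)"
  have ri: "r ?i ?e \<cdot> (r ?i l \<cdot> z) = r ?i l \<cdot> z" if "l \<in> J" "z \<in> T" for z l
    using that by (simp add: same_col flip: assoc)
  have q: "q j i \<in> corner \<epsilon>"
    using j by (simp add: corner_def q_def \<epsilon>_def ri assoc same_row)
  have p: "p \<in> corner \<epsilon>"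
    using j by (simp add: p_def corner_def \<epsilon>_def ri assoc same_row)
  have "q j i \<cdot> p = r ?i j \<cdot> (r i ?e \<cdot> r ?i ?e \<cdot> (r i j \<cdot> r ?i ?e))"
    using j by (simp add: q_def p_def assoc)
  also have "\<dots> = r ?i j \<cdot> (r i ?e \<cdot> r i j \<cdot> r ?i ?e)"
    using j by (simp add: same_row assoc)
  also have "\<dots> = r ?i j \<cdot> r i j \<cdot> r ?i ?e"
    using j by (simp add: same_col assoc)
  also have "\<dots> = \<epsilon>"
    using j by (simp add: same_row same_col \<epsilon>_def)
  finally have qp: "q j i \<cdot> p = \<epsilon>" .
  have "p \<cdot> q j i = r ?i ?e \<cdot> (r i j \<cdot> (r ?i ?e \<cdot> r ?i j \<cdot> r i ?e))"
    using j by (simp add: q_def p_def assoc)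
  also have "\<dots> = r ?i ?e \<cdot> (r i j \<cdot> r ?i j \<cdot> r i ?e)"
    using j by (simp add: same_col assoc)
  also have "\<dots> = \<epsilon>"
    using j by (simp add: same_row same_col \<epsilon>_def)
  finally have pq: "p \<cdot> q j i = \<epsilon>" .
  show ?thesis
    using q p qp pq by (auto simp: Units_def)
qed

definition "U = units_of M"

lemma U_simps [simp]: "carrier U = Units M" "mult U = (\<cdot>)" "one U = \<epsilon>"
  by (simp_all add: U_def units_of_def)

sublocale U: group U
  unfolding U_def by (rule M.units_group)

text \<open>The row \<open>Rel a b\<close> exists for this purpose. Its quotients ab, a, b and 1,
  one for each \<open>Ext s t\<close>, enter through \<open>q_quot\<close>: the value for ab sits in
  column y_0, which is column x_1 times the value for b; column x_1 equals column y_1, and that is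
  the value for a.\<close>

lemma q_mult:
  assumes "a \<in> A" "b \<in> A" "a \<otimes> b \<in> A"
  shows "q (Gen (a \<otimes> b)) (True, False) = q (Gen a) (True, False) \<cdot> q (Gen b) (True, False)"
proof -
  let ?j = "Rel a b"
  have j: "?j \<in> J" using assms by (auto simp: rows_def)
  have u: "q j i \<cdot> \<epsilon> = q j i" "\<epsilon> \<cdot> q j i = q j i" if "j \<in> J" for j i
    using U.r_one[of "q j i"] U.l_one[of "q j i"] q_Unit[OF that, of i] by simp_all
  have "q (Gen (a \<otimes> b)) (True, False) = q ?j (True, False)"
    using q_quot[OF j, of False False] q_first_col[OF j] u assms by simp
  also have "\<dots> = q ?j (False, True) \<cdot> q (Gen b) (True, False)"
    using q_quot[OF j, of False True] by simp
  also have "q ?j (False, True) = q ?j (True, True)"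
    using q_quot[OF j, of True True] q_first_row u j by simp
  also have "q ?j (True, True) = q (Gen a) (True, False)"
    using q_quot[OF j, of True False] q_first_col[OF j] u assms by simp
  finally show ?thesis .
qed

section \<open>The homomorphism \<psi> into the group of units\<close>

lemma ex_psi: "\<exists>\<psi>\<in>hom G U. \<forall>a\<in>A. \<psi> a = q (Gen a) (True, False)"
  by (rule extension[unfolded partial_homs_extend_def, rule_format])
    (auto simp: q_Unit q_mult U.is_group)

definition "\<psi> = (SOME \<psi>. \<psi> \<in> hom G U \<and> (\<forall>a\<in>A. \<psi> a = q (Gen a) (True, False)))"

lemma psi_hom: "\<psi> \<in> hom G U" and psi_A: "a \<in> A \<Longrightarrow> \<psi> a = q (Gen a) (True, False)"
  using someI_ex[OF ex_psi[unfolded Bex_def]] unfolding \<psi>_def by blast+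

sublocale psi: group_hom G U \<psi>
  by unfold_locales (rule psi_hom)

lemma psi_mult: "g \<in> carrier G \<Longrightarrow> h \<in> carrier G \<Longrightarrow> \<psi> (g \<otimes> h) = \<psi> g \<cdot> \<psi> h"
  using psi.hom_mult by simp

lemma psi_one: "\<psi> \<one> = \<epsilon>"
  using psi.hom_one by simp

lemma Units_T:
  assumes "u \<in> Units M" shows "u \<in> T \<and> \<epsilon> \<cdot> u = u \<and> u \<cdot> \<epsilon> = u"
proof -
  have "u \<in> corner \<epsilon>" using M.Units_closed[OF assms] by simp
  then show ?thesis by (simp add: corner_def)
qed

lemma psi_T [simp]: "g \<in> carrier G \<Longrightarrow> \<psi> g \<in> T"
  using psi.hom_closed[of g] Units_T by simp

lemma psi_eps: "g \<in> carrier G \<Longrightarrow> \<psi> g \<cdot> \<epsilon> = \<psi> g" "g \<in> carrier G \<Longrightarrow> \<epsilon> \<cdot> \<psi> g = \<psi> g"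
  using psi.hom_closed[of g] Units_T by simp_all

text \<open>Columns y_t follow from column x_0, where the entry is one and q is \<epsilon>. Column
  x_s is then recovered from y_s by cancelling in the group \<open>U\<close>.\<close>

lemma psi_entry:
  assumes j: "j \<in> J" shows "\<psi> (entry G j i) = q j i"
proof -
  have True_col: "\<psi> (entry G j (True, t)) = q j (True, t)" for t
    using entry_quot[OF j, of False t] q_quot[OF j, of t False] q_first_col[OF j] j
      psi_mult[of "entry G j (False, False)" "quot G False t j"] psi_A
      psi_eps(2)[of "quot G False t j"]
    by (auto simp: rows_def psi_one)
  have "\<psi> (entry G j (False, s)) = q j (False, s)" for s
  proof -
    have u: "q j i \<in> carrier U" if "j \<in> J" for i j
      using q_Unit[OF that] by simp
    have "\<psi> (entry G j (True, s)) = \<psi> (entry G j (False, s)) \<cdot> q (Gen (quot G s s j)) (True, False)"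
      using entry_quot[OF j, of s s] psi_mult[of "entry G j (False, s)" "quot G s s j"] psi_A j
      by simp
    also have "\<psi> (entry G j (True, s)) = q j (False, s) \<cdot> q (Gen (quot G s s j)) (True, False)"
      using True_col q_quot[OF j] by simp
    finally show ?thesis
      using U.right_cancel[of "q (Gen (quot G s s j)) (True, False)" "q j (False, s)"
          "\<psi> (entry G j (False, s))"] u psi.hom_closed[of "entry G j (False, s)"] j
      by simp
  qed
  with True_col show ?thesis by (cases i; cases "fst i") auto
qed

text \<open>The product of \<open>\<psi> g\<close> and \<open>r (False, False) j\<close> represents
  the state \<open>(g, j)\<close>. In the new row, \<open>q l i\<close> times \<open>r i l\<close>
  is \<open>r (False, False) l\<close>, so inverting this unit produces the inverse entry.\<close>

lemma psi_r:
  assumes g: "g \<in> carrier G" and j: "j \<in> J" and l: "l \<in> J"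
  shows "\<psi> g \<cdot> r (False, False) j \<cdot> r i l
    = \<psi> (g \<otimes> entry G j i \<otimes> inv entry G l i) \<cdot> r (False, False) l"
proof -
  let ?i = "(False, False)" and ?e = "Gen \<one>"
  let ?p = "entry G j i" and ?p' = "entry G l i"
  have "\<psi> ?p' \<cdot> r i l = r ?i l \<cdot> (r i ?e \<cdot> r i l)"
    using l by (simp add: psi_entry q_def assoc)
  then have "\<psi> ?p' \<cdot> r i l = r ?i l"
    using l by (simp add: same_col same_row)
  then have "\<psi> (inv ?p') \<cdot> r ?i l = \<psi> (inv ?p') \<cdot> \<psi> ?p' \<cdot> r i l"
    using l by (simp add: assoc del: psi.hom_inv)
  then have a: "\<psi> (inv ?p') \<cdot> r ?i l = \<epsilon> \<cdot> r i l"
    using l psi_mult[of "inv ?p'" ?p'] by (simp add: psi_one del: psi.hom_inv)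
  have "r ?i j \<cdot> r i l = r ?i j \<cdot> (r i ?e \<cdot> r i l)"
    using j l by (simp add: same_col)
  also have "\<dots> = \<psi> ?p \<cdot> r i l"
    using j l by (simp add: psi_entry q_def assoc)
  also have "\<dots> = \<psi> ?p \<cdot> (\<epsilon> \<cdot> r i l)"
    using j l by (simp add: psi_eps flip: assoc)
  also have "\<dots> = \<psi> ?p \<cdot> (\<psi> (inv ?p') \<cdot> r ?i l)"
    by (simp only: a)
  finally show ?thesis
    using g j l by (simp add: psi_mult assoc del: psi.hom_inv)
qed

lemma psi_e:
  assumes g: "g \<in> carrier G" and j: "j \<in> J"
  shows "\<psi> g \<cdot> r (False, False) j \<cdot> e s t
    = \<psi> (g \<otimes> entry G j (False, s)) \<cdot> r (False, False) (Gen (quot G s t j))"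
proof -
  have "\<psi> g \<cdot> r (False, False) j \<cdot> e s t
      = \<psi> g \<cdot> (r (False, False) j \<cdot> r (False, s) (Gen (quot G s t j)))"
    using g j r_e_any[OF j, of s t "(False, s)"] by (simp add: assoc)
  also have "\<dots> = \<psi> g \<cdot> r (False, False) j \<cdot> r (False, s) (Gen (quot G s t j))"
    using g j by (simp add: assoc)
  finally show ?thesis
    using psi_r[OF g j, of "Gen (quot G s t j)" "(False, s)"] g j by simp
qed

section \<open>Bijectivity of \<psi> onto the local monoid\<close>

lemma psi_state:
  assumes "u \<in> T"
  shows "\<forall>g\<in>carrier G. \<forall>j\<in>J. \<psi> g \<cdot> r (False, False) j \<cdot> u
    = \<psi> (fst (\<Phi> u (g, j))) \<cdot> r (False, False) (snd (\<Phi> u (g, j)))"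
  using assms
proof (induction rule: rho_induct)
  case (rep y)
  then show ?case
    by (auto elim!: band_cases simp: Phi_rho psi_r psi_e)
next
  case (mult u v)
  show ?case
  proof (intro ballI)
    fix g j assume gj: "g \<in> carrier G" "j \<in> J"
    obtain g' j' where s: "\<Phi> u (g, j) = (g', j')" by (cases "\<Phi> u (g, j)")
    have s': "g' \<in> carrier G" "j' \<in> J" using Phi_closed[OF mult(1), of "(g, j)"] gj s by auto
    have "\<psi> g \<cdot> r (False, False) j \<cdot> (u \<cdot> v) = \<psi> g \<cdot> r (False, False) j \<cdot> u \<cdot> v"
      using mult(1,2) gj by (simp add: assoc)
    then show "\<psi> g \<cdot> r (False, False) j \<cdot> (u \<cdot> v) = \<psi> (fst (\<Phi> (u \<cdot> v) (g, j))) \<cdot>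
        r (False, False) (snd (\<Phi> (u \<cdot> v) (g, j)))"
      using mult gj s s' by (simp add: Phi_mult)
  qed
qed

text \<open>Starting from the state that represents \<epsilon>, \<open>psi_state\<close> writes u as
  \<open>\<psi> g\<close> times \<open>r (False, False) j\<close>; multiplying by \<epsilon> on the
  right then removes the row.\<close>

lemma psi_surj: "corner \<epsilon> \<subseteq> \<psi> ` carrier G"
proof
  fix u assume "u \<in> corner \<epsilon>"
  then have u: "u \<in> T" "\<epsilon> \<cdot> u = u" "u \<cdot> \<epsilon> = u" by (auto simp: corner_def)
  obtain g j where s: "\<Phi> u (\<one>, Gen \<one>) = (g, j)" by (cases "\<Phi> u (\<one>, Gen \<one>)")
  have gj: "g \<in> carrier G" "j \<in> J" using Phi_closed[OF u(1), of "(\<one>, Gen \<one>)"] s by auto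
  have "\<epsilon> \<cdot> \<epsilon> \<cdot> u = \<psi> g \<cdot> r (False, False) j"
    using psi_state[OF u(1), rule_format, of "\<one>" "Gen \<one>"] s by (simp add: psi_one flip: \<epsilon>_def)
  then have "u = \<psi> g \<cdot> r (False, False) j"
    using u by (simp add: eps_idem)
  then have "u = \<psi> g \<cdot> r (False, False) j \<cdot> \<epsilon>"
    using u by simp
  also have "\<dots> = \<psi> g \<cdot> \<epsilon>"
    using gj by (simp add: assoc \<epsilon>_def same_col)
  finally show "u \<in> \<psi> ` carrier G"
    using gj by (auto simp: psi_eps)
qed

text \<open>This yields injectivity, since h can be read off from the image of
  \<open>(\<one>, Gen \<one>)\<close>. The induction follows \<open>generate\<close>; for a in A,
  the two factors of \<open>q (Gen a) (True, False)\<close> pick up the entry a.\<close>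

lemma Phi_psi:
  assumes "h \<in> carrier G"
  shows "\<forall>g\<in>carrier G. \<Phi> (\<psi> h) (g, Gen \<one>) = (g \<otimes> h, Gen \<one>)"
proof -
  have one: "\<Phi> \<epsilon> (g, Gen \<one>) = (g, Gen \<one>)" if "g \<in> carrier G" for g
    using that by (simp add: \<epsilon>_def Phi_rho)
  have A: "\<Phi> (\<psi> a) (g, Gen \<one>) = (g \<otimes> a, Gen \<one>)" if "a \<in> A" "g \<in> carrier G" for a g
    using that by (simp add: psi_A q_def Phi_mult Phi_rho)
  have inv: "\<Phi> (\<psi> (inv h)) (g, Gen \<one>) = (g \<otimes> inv h, Gen \<one>)"
    if h: "h \<in> carrier G" "g \<in> carrier G"
      and IH: "\<forall>g\<in>carrier G. \<Phi> (\<psi> h) (g, Gen \<one>) = (g \<otimes> h, Gen \<one>)" for h g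
  proof -
    \<comment> \<open>From \<open>g \<otimes> inv h\<close> the first factor leads to g, while the
      whole product is \<epsilon> and fixes the state.\<close>
    have "\<Phi> (\<psi> h \<cdot> \<psi> (inv h)) (g \<otimes> inv h, Gen \<one>) = \<Phi> (\<psi> (inv h)) (g, Gen \<one>)"
      using h IH by (subst Phi_mult) (auto simp: m_assoc simp del: psi.hom_inv)
    moreover have "\<psi> h \<cdot> \<psi> (inv h) = \<epsilon>"
      using h psi_mult[of h "inv h"] by (simp add: psi_one del: psi.hom_inv)
    ultimately show ?thesis using one h by simp
  qed
  have gen: "h' \<in> carrier G" if "h' \<in> generate G A" for h'
    using that by (simp add: generates)
  have "h \<in> generate G A" using assms generates by simp
  then show ?thesis
  proof induction
    case (eng h1 h2)
    then show ?case
      using gen by (simp add: psi_mult Phi_mult m_assoc)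
  qed (use one A inv in \<open>auto simp: psi_one\<close>)
qed

theorem maximal_subgroup_iso:
  "\<exists>H e. maximal_subgroup T (\<cdot>) H e \<and> G \<cong> group_on H (\<cdot>) e"
proof (intro exI conjI)
  \<comment> \<open>By surjectivity every element of the local monoid is a value of \<psi> and thus
    a unit.\<close>
  have eq: "Units M = corner \<epsilon>"
    using psi_surj psi.hom_closed M.Units_closed by auto
  then have "group M"
    by (intro M.group_l_invI) (metis M.Units_l_inv_ex M_simps)
  then show "maximal_subgroup T (\<cdot>) (corner \<epsilon>) \<epsilon>"
    by (intro maximal_subgroup_corner eps_idem) auto
  have "inj_on \<psi> (carrier G)"
    using Phi_psi[rule_format, of _ "\<one>"] by (intro inj_onI) (metis fst_conv l_one one_closed)
  moreover have "\<psi> \<in> hom G M"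
    using psi_hom eq by (auto simp: hom_def)
  moreover have "\<psi> ` carrier G = corner \<epsilon>"
    using psi_surj psi.hom_closed eq by auto
  ultimately show "G \<cong> M"
    by (intro is_isoI[of \<psi>]) (simp add: iso_iff)
qed

end

section \<open>Free idempotent generated semigroups\<close>

text \<open>Serves both the action of IG and homomorphisms out of free groups, where the states are
  elements of the target. The invariant set \<open>Q\<close> is there because the relations are
  respected only on genuine states.\<close>

lemma foldl_word_cong:
  assumes "(u, v) \<in> word_cong X R" and "s \<in> Q"
    and closed: "\<And>s x. s \<in> Q \<Longrightarrow> x \<in> X \<Longrightarrow> f s x \<in> Q"
    and rel: "\<And>u v s. (u, v) \<in> R \<Longrightarrow> s \<in> Q \<Longrightarrow> foldl f s u = foldl f s v"
  shows "foldl f s u = foldl f s v"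
  using assms(1,2)
proof (induction arbitrary: s)
  case (rel u v p q)
  have "foldl f s p \<in> Q"
    using \<open>p \<in> lists X\<close> \<open>s \<in> Q\<close> by (induction arbitrary: s) (auto intro: closed)
  then show ?case using assms(4)[OF rel(1)] by simp
qed auto

lemma foldl_closed:
  assumes "w \<in> lists X" "s \<in> Q" "\<And>s x. s \<in> Q \<Longrightarrow> x \<in> X \<Longrightarrow> f s x \<in> Q"
  shows "foldl f s w \<in> Q"
  using assms(1,2) by (induction arbitrary: s) (auto intro: assms(3))

abbreviation IG_class :: "'b set \<Rightarrow> ('b \<Rightarrow> 'b \<Rightarrow> 'b) \<Rightarrow> 'b list \<Rightarrow> 'b list set" where
  "IG_class S m w \<equiv> IG_cong S m `` {w}"

lemma IG_mult_class:
  assumes "u \<in> lists (idempotents S m)" "v \<in> lists (idempotents S m)"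
  shows "IG_mult S m (IG_class S m u) (IG_class S m v) = IG_class S m (u @ v)"
  using assms by (simp add: IG_mult_def IG_cong_def class_mult_classes)

lemma IG_class_in_carrier:
  "w \<in> lists (idempotents S m) \<Longrightarrow> w \<noteq> [] \<Longrightarrow> IG_class S m w \<in> IG_carrier S m"
  by (simp add: IG_carrier_def quotientI)

lemma IG_carrier_cases:
  assumes "t \<in> IG_carrier S m"
  obtains w where "w \<in> lists (idempotents S m)" "w \<noteq> []" "t = IG_class S m w"
  using assms by (auto simp: IG_carrier_def elim!: quotientE)

lemma IG_mult_basic_pair:
  assumes "e \<in> idempotents S m" "f \<in> idempotents S m" "m e f \<in> idempotents S m"
    and "basic_pair m e f"
  shows "IG_mult S m (IG_class S m [e]) (IG_class S m [f]) = IG_class S m [m e f]"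
proof -
  have "([] @ [e, f] @ [], [] @ [m e f] @ []) \<in> IG_cong S m"
    unfolding IG_cong_def using assms by (intro word_cong.rel) (auto simp: IG_rels_def)
  then have "IG_class S m [e, f] = IG_class S m [m e f]"
    unfolding IG_cong_def by (intro equiv_class_eq[OF equiv_word_cong]) simp
  then show ?thesis
    using assms by (simp add: IG_mult_class)
qed

lemma IG_induct [consumes 1, case_names idempotent mult]:
  assumes "t \<in> IG_carrier S m"
    and idem: "\<And>e. e \<in> idempotents S m \<Longrightarrow> P (IG_class S m [e])"
    and mult: "\<And>u v. \<lbrakk>u \<in> IG_carrier S m; v \<in> IG_carrier S m; P u; P v\<rbrakk> \<Longrightarrow> P (IG_mult S m u v)"
  shows "P t"
proof -
  have "P (IG_class S m w)" if "w \<in> lists (idempotents S m)" "w \<noteq> []" for w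
    using that(2,1)
  proof (induction w rule: list_nonempty_induct)
    case (cons e w)
    then have "P (IG_mult S m (IG_class S m [e]) (IG_class S m w))"
      using idem by (intro mult) (auto intro: IG_class_in_carrier)
    then show ?case using cons by (simp add: IG_mult_class)
  qed (auto intro: idem)
  with assms(1) show ?thesis
    by (elim IG_carrier_cases) simp
qed

text \<open>A class acts through an arbitrary representative; \<open>IG_act_class\<close> shows that
  the choice is immaterial on the invariant set of states.\<close>

definition IG_act :: "('s \<Rightarrow> 'b \<Rightarrow> 's) \<Rightarrow> 'b list set \<Rightarrow> 's \<Rightarrow> 's" where
  "IG_act f t s = foldl f s (SOME w. w \<in> t)"

lemma IG_act_class:
  assumes "w \<in> lists (idempotents S m)" and "s \<in> Q"
    and closed: "\<And>s x. s \<in> Q \<Longrightarrow> x \<in> idempotents S m \<Longrightarrow> f s x \<in> Q"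
    and basic: "\<And>s e e'. \<lbrakk>s \<in> Q; e \<in> idempotents S m; e' \<in> idempotents S m; basic_pair m e e'\<rbrakk>
      \<Longrightarrow> f (f s e) e' = f s (m e e')"
  shows "IG_act f (IG_class S m w) s = foldl f s w"
proof -
  have "w \<in> IG_class S m w"
    using assms(1) by (auto simp: IG_cong_def intro: word_cong.refl)
  then have "(SOME w'. w' \<in> IG_class S m w) \<in> IG_class S m w"
    by (rule someI)
  then have "foldl f s w = foldl f s (SOME w'. w' \<in> IG_class S m w)"
    unfolding IG_cong_def
    by (intro foldl_word_cong[OF _ \<open>s \<in> Q\<close> closed]) (auto simp: IG_rels_def basic)
  then show ?thesis by (simp add: IG_act_def)
qed

section \<open>Finitely presented groups\<close>

lemma (in group) normal_closure_normal:
  assumes "R \<subseteq> carrier G" shows "normal_closure G R \<lhd> G"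
proof -
  \<comment> \<open>The whole group makes the family nonempty; an empty intersection would be the
    universal set.\<close>
  have "carrier G \<lhd> G"
    by (rule normal_invI) (auto intro: subgroup_self)
  then have ne: "{N. N \<lhd> G \<and> R \<subseteq> N} \<noteq> {}"
    using assms by blast
  show ?thesis
    unfolding normal_closure_def
    using ne by (intro normal_invI subgroups_Inter) (auto dest: normal_invE normal_imp_subgroup)
qed

lemma normal_closure_least: "N \<lhd> G \<Longrightarrow> R \<subseteq> N \<Longrightarrow> normal_closure G R \<subseteq> N"
  by (auto simp: normal_closure_def)

abbreviation free_group_class :: "'x set \<Rightarrow> ('x \<times> bool) list \<Rightarrow> ('x \<times> bool) list set" where
  "free_group_class X w \<equiv> free_group_cong X `` {w}"

lemma free_group_class_closed:
  "w \<in> lists (X \<times> UNIV) \<Longrightarrow> free_group_class X w \<in> carrier (free_group X)"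
  by (simp add: free_group_def quotientI)

lemma free_group_cases:
  assumes "u \<in> carrier (free_group X)"
  obtains w where "w \<in> lists (X \<times> UNIV)" "u = free_group_class X w"
  using assms by (auto simp: free_group_def elim!: quotientE)

lemma free_group_mult_class:
  "u \<in> lists (X \<times> UNIV) \<Longrightarrow> v \<in> lists (X \<times> UNIV) \<Longrightarrow>
    free_group_class X u \<otimes>\<^bsub>free_group X\<^esub> free_group_class X v = free_group_class X (u @ v)"
  by (simp add: free_group_def free_group_cong_def class_mult_classes)

lemma free_group_one: "\<one>\<^bsub>free_group X\<^esub> = free_group_class X []"
  by (simp add: free_group_def)

lemma free_group_inverse_letters:
  assumes "x \<in> X"
  shows "free_group_class X [(x, b)] \<otimes>\<^bsub>free_group X\<^esub> free_group_class X [(x, \<not> b)]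
    = \<one>\<^bsub>free_group X\<^esub>"
proof -
  have "([] @ [(x, b), (x, \<not> b)] @ [], [] @ [] @ []) \<in> free_group_cong X"
    unfolding free_group_cong_def using assms by (intro word_cong.rel) auto
  then have "free_group_class X [(x, b), (x, \<not> b)] = free_group_class X []"
    unfolding free_group_cong_def by (intro equiv_class_eq[OF equiv_word_cong]) simp
  then show ?thesis
    using assms by (simp add: free_group_mult_class free_group_one)
qed

text \<open>A word is evaluated by right multiplication with its letters, starting at one. As b
  ranges over both signs, \<open>inv\<close> says that formal inverses go to inverses.\<close>

lemma free_group_hom_exists:
  assumes "group H" and f: "f \<in> X \<times> UNIV \<rightarrow> carrier H"
    and inv: "\<And>x b. x \<in> X \<Longrightarrow> f (x, b) \<otimes>\<^bsub>H\<^esub> f (x, \<not> b) = \<one>\<^bsub>H\<^esub>"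
  obtains \<Theta> where "\<Theta> \<in> hom (free_group X) H"
    "\<And>l. l \<in> X \<times> UNIV \<Longrightarrow> \<Theta> (free_group_class X [l]) = f l"
proof -
  interpret H: group H by fact
  let ?op = "\<lambda>h l. h \<otimes>\<^bsub>H\<^esub> f l"
  define \<Theta> where "\<Theta> u = foldl ?op \<one>\<^bsub>H\<^esub> (SOME w. w \<in> u)" for u
  have fc: "f l \<in> carrier H" if "l \<in> X \<times> UNIV" for l using f that by blast
  have closed: "foldl ?op h w \<in> carrier H" if "w \<in> lists (X \<times> UNIV)" "h \<in> carrier H" for w h
    using that by (rule foldl_closed) (auto intro: fc)
  have cong: "foldl ?op \<one>\<^bsub>H\<^esub> u = foldl ?op \<one>\<^bsub>H\<^esub> v" if "(u, v) \<in> free_group_cong X" for u v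
    using that unfolding free_group_cong_def
    by (rule foldl_word_cong[OF _ H.one_closed]) (auto simp: fc inv H.m_assoc)
  have \<Theta>: "\<Theta> (free_group_class X w) = foldl ?op \<one>\<^bsub>H\<^esub> w" if "w \<in> lists (X \<times> UNIV)" for w
  proof -
    have "w \<in> free_group_class X w"
      using that by (auto simp: free_group_cong_def intro: word_cong.refl)
    then have "(SOME w'. w' \<in> free_group_class X w) \<in> free_group_class X w"
      by (rule someI)
    then have "foldl ?op \<one>\<^bsub>H\<^esub> w = foldl ?op \<one>\<^bsub>H\<^esub> (SOME w'. w' \<in> free_group_class X w)"
      by (intro cong) simp
    then show ?thesis by (simp add: \<Theta>_def)
  qed
  have mult: "foldl ?op h w = h \<otimes>\<^bsub>H\<^esub> foldl ?op \<one>\<^bsub>H\<^esub> w"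
    if "w \<in> lists (X \<times> UNIV)" "h \<in> carrier H" for w h
    using that(1)
  proof (induction w rule: rev_induct)
    case (snoc l w)
    then have "foldl ?op h (w @ [l]) = h \<otimes>\<^bsub>H\<^esub> foldl ?op \<one>\<^bsub>H\<^esub> w \<otimes>\<^bsub>H\<^esub> f l"
      by simp
    then show ?case
      using snoc.prems that(2) closed[of w "\<one>\<^bsub>H\<^esub>"] fc[of l] by (simp add: H.m_assoc)
  qed (simp add: that(2))
  show ?thesis
  proof
    show "\<Theta> \<in> hom (free_group X) H"
    proof (rule homI)
      fix u v assume "u \<in> carrier (free_group X)" "v \<in> carrier (free_group X)"
      then obtain w w' where "w \<in> lists (X \<times> UNIV)" "w' \<in> lists (X \<times> UNIV)"
        "u = free_group_class X w" "v = free_group_class X w'"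
        by (elim free_group_cases) simp
      then show "\<Theta> (u \<otimes>\<^bsub>free_group X\<^esub> v) = \<Theta> u \<otimes>\<^bsub>H\<^esub> \<Theta> v"
        by (simp add: free_group_mult_class \<Theta> closed mult[of w' "foldl ?op \<one>\<^bsub>H\<^esub> w"])
    next
      fix u assume "u \<in> carrier (free_group X)"
      then obtain w where "w \<in> lists (X \<times> UNIV)" "u = free_group_class X w"
        by (rule free_group_cases)
      then show "\<Theta> u \<in> carrier H"
        by (simp only: \<Theta> closed H.one_closed)
    qed
    show "\<Theta> (free_group_class X [l]) = f l" if "l \<in> X \<times> UNIV" for l
      using that fc[OF that] by (subst \<Theta>) auto
  qed
qed

lemma hom_factor:
  assumes F: "group F" and G: "group G" and H: "group H"
    and \<eta>: "\<eta> \<in> hom F G" "\<eta> ` carrier F = carrier G"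
    and \<Theta>: "\<Theta> \<in> hom F H" and ker: "kernel F G \<eta> \<subseteq> kernel F H \<Theta>"
  shows "\<exists>\<psi>\<in>hom G H. \<forall>u\<in>carrier F. \<psi> (\<eta> u) = \<Theta> u"
proof -
  interpret F: group F by fact
  interpret eta: group_hom F G \<eta> using F G \<eta> by (simp add: group_hom_def group_hom_axioms_def)
  interpret Th: group_hom F H \<Theta> using F H \<Theta> by (simp add: group_hom_def group_hom_axioms_def)
  have wd: "\<Theta> u = \<Theta> v" if uv: "u \<in> carrier F" "v \<in> carrier F" "\<eta> u = \<eta> v" for u v
  proof -
    have "u \<otimes>\<^bsub>F\<^esub> inv\<^bsub>F\<^esub> v \<in> kernel F G \<eta>"
      using uv by (simp add: kernel_def)
    then have "u \<otimes>\<^bsub>F\<^esub> inv\<^bsub>F\<^esub> v \<in> kernel F H \<Theta>"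
      using ker by blast
    then have "\<Theta> u \<otimes>\<^bsub>H\<^esub> inv\<^bsub>H\<^esub> \<Theta> v = \<one>\<^bsub>H\<^esub>"
      using uv by (simp add: kernel_def)
    then show ?thesis
      using uv Th.H.inv_solve_right'[of "\<one>\<^bsub>H\<^esub>" "\<Theta> u" "\<Theta> v"] by simp
  qed
  define \<psi> where "\<psi> g = \<Theta> (inv_into (carrier F) \<eta> g)" for g
  have val: "\<psi> (\<eta> u) = \<Theta> u" if "u \<in> carrier F" for u
    unfolding \<psi>_def using that
    by (intro wd inv_into_into f_inv_into_f imageI)
  show ?thesis
  proof (intro bexI ballI)
    show "\<psi> \<in> hom G H"
    proof (rule homI)
      fix g h assume "g \<in> carrier G" "h \<in> carrier G"
      then obtain u v where uv: "u \<in> carrier F" "v \<in> carrier F" "g = \<eta> u" "h = \<eta> v"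
        using \<eta>(2) by (metis imageE)
      then have "g \<otimes>\<^bsub>G\<^esub> h = \<eta> (u \<otimes>\<^bsub>F\<^esub> v)" by simp
      then show "\<psi> (g \<otimes>\<^bsub>G\<^esub> h) = \<psi> g \<otimes>\<^bsub>H\<^esub> \<psi> h"
        using uv by (simp add: val del: eta.hom_mult)
    next
      fix g assume "g \<in> carrier G"
      then show "\<psi> g \<in> carrier H" using \<eta>(2) val by (metis Th.hom_closed imageE)
    qed
  qed (rule val)
qed

text \<open>All prefixes of the chosen relator words have values in A, so the triangular relations
  evaluate relators letter by letter. The homomorphism given by \<theta> on letters therefore kills
  the relators and factors through G.\<close>

lemma finitely_presented_cover:
  assumes G: "group G" and fp: "finitely_presented G"
  shows "\<exists>A. finite A \<and> partial_group G A \<and> partial_homs_extend TYPE('t) G A"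
proof -
  interpret G: group G by fact
  obtain X :: "nat set" and R where X: "finite X" and R: "finite R" "R \<subseteq> carrier (free_group X)"
    and iso: "G \<cong> free_group X Mod normal_closure (free_group X) R"
    using fp unfolding finitely_presented_def by blast
  define F where "F = free_group X"
  define N where "N = normal_closure F R"
  let ?W = "lists (X \<times> (UNIV :: bool set))" and ?c = "free_group_class X"
  interpret F: group F unfolding F_def by (rule group_free_group)
  interpret N: normal N F
    unfolding N_def using R(2) by (intro F.normal_closure_normal) (simp add: F_def)
  obtain k where k: "k \<in> iso (F Mod N) G"
    using G.iso_sym[OF iso] unfolding is_iso_def F_def N_def by blast
  define \<eta> where "\<eta> = k \<circ> (\<lambda>u. N #>\<^bsub>F\<^esub> u)"
  have khom: "k \<in> hom (F Mod N) G" and kinj: "inj_on k (carrier (F Mod N))"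
    and ksurj: "k ` carrier (F Mod N) = carrier G"
    using k by (auto simp: iso_iff)
  have eta_hom: "\<eta> \<in> hom F G"
    unfolding \<eta>_def by (rule hom_compose[OF N.r_coset_hom_Mod khom])
  have carrier_Mod: "carrier (F Mod N) = (\<lambda>u. N #>\<^bsub>F\<^esub> u) ` carrier F"
    by (auto simp: FactGroup_def RCOSETS_def)
  then have eta_surj: "\<eta> ` carrier F = carrier G"
    using ksurj by (simp add: \<eta>_def image_comp)
  interpret eta: group_hom F G \<eta>
    by unfold_locales (rule eta_hom)
  have ker_eta: "kernel F G \<eta> \<subseteq> N"
  proof
    fix u assume "u \<in> kernel F G \<eta>"
    then have u: "u \<in> carrier F" "\<eta> u = \<eta> \<one>\<^bsub>F\<^esub>" by (auto simp: kernel_def)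
    then have "N #>\<^bsub>F\<^esub> u = N #>\<^bsub>F\<^esub> \<one>\<^bsub>F\<^esub>"
      by (intro inj_onD[OF kinj]) (simp_all add: \<eta>_def carrier_Mod)
    then have "N #>\<^bsub>F\<^esub> u = N"
      using F.coset_mult_one[OF N.subset] by simp
    then show "u \<in> N" using F.coset_join1 u N.is_subgroup by blast
  qed
  obtain n where n: "n \<ge> 1" "\<forall>r\<in>R. \<exists>w\<in>?W. r = ?c w \<and> length w \<le> n"
  proof -
    have "\<forall>r\<in>R. \<exists>w. w \<in> ?W \<and> r = ?c w"
      using R(2) by (auto dest!: subsetD elim!: free_group_cases)
    then obtain w where w: "\<forall>r\<in>R. w r \<in> ?W \<and> r = ?c (w r)" by metis
    \<comment> \<open>The successor makes the bound at least 1, so that single letters count as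
      short even if \<open>R\<close> is empty.\<close>
    have "length (w r) \<le> Suc (Max (length ` w ` R))" if "r \<in> R" for r
      using that R(1) by (intro le_SucI Max_ge) auto
    with w have "\<forall>r\<in>R. \<exists>v\<in>?W. r = ?c v \<and> length v \<le> Suc (Max (length ` w ` R))"
      by blast
    then show ?thesis by (intro that[of "Suc (Max (length ` w ` R))"]) simp_all
  qed
  define A where "A = (\<lambda>w. \<eta> (?c w)) ` {w \<in> ?W. length w \<le> n}"
  have cW: "?c w \<in> carrier F" if "w \<in> ?W" for w
    unfolding F_def using that by (rule free_group_class_closed)
  have A_I: "\<eta> (?c w) \<in> A" if "w \<in> ?W" "length w \<le> n" for w
    using that by (auto simp: A_def)
  have eta_snoc: "\<eta> (?c (w @ [l])) = \<eta> (?c w) \<otimes>\<^bsub>G\<^esub> \<eta> (?c [l])" if "w \<in> ?W" "l \<in> X \<times> UNIV" for w l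
    using that cW[of w] cW[of "[l]"] eta.hom_mult[of "?c w" "?c [l]"]
    by (simp add: F_def free_group_mult_class)
  have one: "\<eta> (?c []) = \<one>\<^bsub>G\<^esub>"
    using eta.hom_one by (simp add: F_def free_group_one)
  have letter_A: "\<eta> (?c [l]) \<in> A" if "l \<in> X \<times> UNIV" for l
    using that n(1) by (intro A_I) auto
  have one_A: "\<one>\<^bsub>G\<^esub> \<in> A" using A_I[of "[]"] one by simp
  have A_sub: "A \<subseteq> carrier G"
    unfolding A_def using eta.hom_closed[OF cW] by blast
  show ?thesis
    unfolding partial_homs_extend_def
  proof (intro exI[of _ A] conjI allI impI)
    show "finite A"
      using finite_lists_length_le[of "X \<times> (UNIV :: bool set)" n] X
      unfolding A_def lists_eq_set by (simp add: conj_commute)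
    have "\<eta> (?c w) \<in> generate G A" if "w \<in> ?W" for w
      using that
    proof (induction w rule: rev_induct)
      case Nil
      then show ?case using one generate.one by simp
    next
      case (snoc l w)
      then show ?case
        using eta_snoc[of w l] generate.eng[OF snoc.IH generate.incl[OF letter_A[of l]]] by simp
    qed
    then have "\<eta> u \<in> generate G A" if "u \<in> carrier F" for u
      using that unfolding F_def by (elim free_group_cases) simp
    then have "carrier G \<subseteq> generate G A"
      unfolding eta_surj[symmetric] by blast
    then show "partial_group G A"
      using G.generate_incl[OF A_sub] A_sub one_A by unfold_locales auto
    fix H :: "'t monoid" and \<theta>
    assume *: "group H \<and> \<theta> \<in> A \<rightarrow> carrier H \<and>
      (\<forall>a\<in>A. \<forall>b\<in>A. a \<otimes>\<^bsub>G\<^esub> b \<in> A \<longrightarrow> \<theta> (a \<otimes>\<^bsub>G\<^esub> b) = \<theta> a \<otimes>\<^bsub>H\<^esub> \<theta> b)"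
    then have H: "group H" and \<theta>: "\<theta> \<in> A \<rightarrow> carrier H"
      and mult: "\<And>a b. \<lbrakk>a \<in> A; b \<in> A; a \<otimes>\<^bsub>G\<^esub> b \<in> A\<rbrakk> \<Longrightarrow> \<theta> (a \<otimes>\<^bsub>G\<^esub> b) = \<theta> a \<otimes>\<^bsub>H\<^esub> \<theta> b"
      by auto
    interpret H: group H by fact
    have theta_A: "\<theta> a \<in> carrier H" if "a \<in> A" for a using \<theta> that by blast
    have theta_one: "\<theta> \<one>\<^bsub>G\<^esub> = \<one>\<^bsub>H\<^esub>"
      using mult[OF one_A one_A] one_A theta_A[OF one_A] H.r_cancel_one'[of "\<theta> \<one>\<^bsub>G\<^esub>" "\<theta> \<one>\<^bsub>G\<^esub>"]
      by simp
    obtain \<Theta> where \<Theta>: "\<Theta> \<in> hom (free_group X) H"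
      "\<And>l. l \<in> X \<times> UNIV \<Longrightarrow> \<Theta> (?c [l]) = \<theta> (\<eta> (?c [l]))"
    proof (rule free_group_hom_exists[OF H, of "\<lambda>l. \<theta> (\<eta> (?c [l]))" X])
      fix x b assume x: "x \<in> X"
      have "\<eta> (?c [(x, b)]) \<otimes>\<^bsub>G\<^esub> \<eta> (?c [(x, \<not> b)]) = \<one>\<^bsub>G\<^esub>"
        using free_group_inverse_letters[OF x, of b] x cW[of "[(x, _)]"]
          eta.hom_mult[of "?c [(x, b)]" "?c [(x, \<not> b)]"] eta.hom_one
        by (simp add: F_def)
      then show "\<theta> (\<eta> (?c [(x, b)])) \<otimes>\<^bsub>H\<^esub> \<theta> (\<eta> (?c [(x, \<not> b)])) = \<one>\<^bsub>H\<^esub>"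
        using mult[of "\<eta> (?c [(x, b)])" "\<eta> (?c [(x, \<not> b)])"] x letter_A one_A theta_one by simp
    qed (use theta_A letter_A in auto)
    interpret Th: group_hom F H \<Theta>
      using \<Theta>(1) by unfold_locales (simp add: F_def)
    have short: "\<Theta> (?c w) = \<theta> (\<eta> (?c w))" if "w \<in> ?W" "length w \<le> n" for w
      using that
    proof (induction w rule: rev_induct)
      case Nil
      then show ?case
        using one theta_one Th.hom_one by (simp add: F_def free_group_one)
    next
      case (snoc l w)
      have l: "l \<in> X \<times> UNIV" "w \<in> ?W" using snoc.prems by auto
      have "\<Theta> (?c (w @ [l])) = \<Theta> (?c w) \<otimes>\<^bsub>H\<^esub> \<Theta> (?c [l])"
        using l cW[of w] cW[of "[l]"] Th.hom_mult[of "?c w" "?c [l]"]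
        by (simp add: F_def free_group_mult_class)
      also have "\<dots> = \<theta> (\<eta> (?c w)) \<otimes>\<^bsub>H\<^esub> \<theta> (\<eta> (?c [l]))"
        using snoc \<Theta>(2) l by simp
      \<comment> \<open>The prefix, the last letter and the whole word are all short, so their
        values form a triangular relation in A.\<close>
      also have "\<dots> = \<theta> (\<eta> (?c (w @ [l])))"
        using mult[of "\<eta> (?c w)" "\<eta> (?c [l])"] l snoc.prems A_I[of w] A_I[of "w @ [l]"] letter_A
        by (simp add: eta_snoc)
      finally show ?case .
    qed
    have R_eta: "\<eta> r = \<one>\<^bsub>G\<^esub>" if "r \<in> R" for r
    proof -
      have r: "r \<in> N" unfolding N_def normal_closure_def using that by blast
      then have "N #>\<^bsub>F\<^esub> r = N #>\<^bsub>F\<^esub> \<one>\<^bsub>F\<^esub>"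
        using F.coset_join2[OF N.mem_carrier[OF r] N.is_subgroup r] F.coset_mult_one[OF N.subset] by simp
      then show ?thesis using eta.hom_one by (simp add: \<eta>_def)
    qed
    have "R \<subseteq> kernel F H \<Theta>"
    proof
      fix r assume r: "r \<in> R"
      then obtain w where w: "w \<in> ?W" "r = ?c w" "length w \<le> n" using n(2) by blast
      then show "r \<in> kernel F H \<Theta>"
        using short[of w] R_eta[OF r] theta_one cW by (simp add: kernel_def)
    qed
    then have "N \<subseteq> kernel F H \<Theta>"
      unfolding N_def by (intro normal_closure_least Th.normal_kernel)
    with ker_eta have ker: "kernel F G \<eta> \<subseteq> kernel F H \<Theta>" by blast
    obtain \<psi> where \<psi>: "\<psi> \<in> hom G H" "\<forall>u\<in>carrier F. \<psi> (\<eta> u) = \<Theta> u"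
      using hom_factor[OF F.is_group G H eta_hom eta_surj Th.homh ker] by blast
    have "\<psi> a = \<theta> a" if a: "a \<in> A" for a
    proof -
      obtain w where w: "w \<in> ?W" "length w \<le> n" "a = \<eta> (?c w)"
        using a unfolding A_def by blast
      then show ?thesis using \<psi>(2)[rule_format, OF cW[OF w(1)]] short by simp
    qed
    with \<psi>(1) show "\<exists>\<psi>\<in>hom G H. \<forall>a\<in>A. \<psi> a = \<theta> a" by blast
  qed
qed

section \<open>Encoding the band\<close>

context partial_group
begin

text \<open>Transports the band along an injection to the type used in the final statement. Elements
  of IG are then sets of words over \<open>'e\<close>, which determines the type in
  \<open>extension\<close>.\<close>

lemma band_encoded:
  fixes enc :: "'a elt \<Rightarrow> 'e"
  defines "B \<equiv> enc ` band_carrier G A"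
    and "m \<equiv> \<lambda>u v. enc (band_mult G (inv_into UNIV enc u) (inv_into UNIV enc v))"
  assumes enc: "inj enc"
    and extension: "partial_homs_extend TYPE('e list set) G A"
  shows "is_band B m" "IG_has_maximal_subgroup_iso B m G"
proof -
  have m: "m (enc x) (enc y) = enc (band_mult G x y)" for x y
    by (simp add: m_def enc)
  have bp: "basic_pair m (enc x) (enc y) \<longleftrightarrow> basic_pair (band_mult G) x y" for x y
    using enc by (auto simp: basic_pair_def m dest: injD)
  show band: "is_band B m"
    by (auto simp: is_band_def is_semigroup_def B_def m band_mult_closed band_mult_assoc band_mult_idem)
  have idem: "idempotents B m = B"
    using band by (auto simp: idempotents_def is_band_def)
  define f where "f s b = act G s (inv_into UNIV enc b)" for s b
  have f: "f s (enc x) = act G s x" for s x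
    by (simp add: f_def enc)
  have f_closed: "f s b \<in> carrier G \<times> J" if s: "s \<in> carrier G \<times> J" and b: "b \<in> idempotents B m" for s b
  proof -
    obtain x where "x \<in> band_carrier G A" "b = enc x"
      using b unfolding idem by (auto simp: B_def)
    then show ?thesis using act_closed s by (simp only: f)
  qed
  have f_basic: "f (f s b) b' = f s (m b b')"
    if s: "s \<in> carrier G \<times> J" and b: "b \<in> idempotents B m" "b' \<in> idempotents B m"
      and basic: "basic_pair m b b'" for s b b'
  proof -
    obtain x y where "x \<in> band_carrier G A" "b = enc x" "y \<in> band_carrier G A" "b' = enc y"
      using b unfolding idem by (auto simp: B_def)
    then show ?thesis using act_basic_pair s basic by (simp only: f m bp)
  qed
  have act_class: "IG_act f (IG_class B m w) s = foldl f s w"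
    if "w \<in> lists (idempotents B m)" "s \<in> carrier G \<times> J" for w s
    using that f_closed f_basic by (rule IG_act_class)
  let ?\<rho> = "\<lambda>x. IG_class B m [enc x]"
  have enc_B: "enc x \<in> idempotents B m" if "x \<in> band_carrier G A" for x
    unfolding idem using that by (simp add: B_def)
  have "band_representation G A (IG_carrier B m) (IG_mult B m) ?\<rho> (IG_act f)"
  proof unfold_locales
    fix x y z
    assume "x \<in> IG_carrier B m" "y \<in> IG_carrier B m"
    then show "IG_mult B m x y \<in> IG_carrier B m"
      using is_semigroup_IG[of B m] by (simp add: is_semigroup_def)
    assume "z \<in> IG_carrier B m"
    with \<open>x \<in> _\<close> \<open>y \<in> _\<close> show "IG_mult B m (IG_mult B m x y) z = IG_mult B m x (IG_mult B m y z)"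
      using is_semigroup_IG[of B m] by (simp add: is_semigroup_def)
  next
    fix x assume "x \<in> band_carrier G A"
    then show "?\<rho> x \<in> IG_carrier B m"
      by (intro IG_class_in_carrier) (auto intro: enc_B)
  next
    fix x y assume "x \<in> band_carrier G A" "y \<in> band_carrier G A" "basic_pair (band_mult G) x y"
    then show "IG_mult B m (?\<rho> x) (?\<rho> y) = ?\<rho> (band_mult G x y)"
      using IG_mult_basic_pair[of "enc x" B m "enc y"] by (simp add: m bp enc_B band_mult_closed)
  next
    fix u P
    assume "u \<in> IG_carrier B m" "\<And>x. x \<in> band_carrier G A \<Longrightarrow> P (?\<rho> x)"
      and "\<And>u v. u \<in> IG_carrier B m \<Longrightarrow> v \<in> IG_carrier B m \<Longrightarrow> P u \<Longrightarrow> P v \<Longrightarrow> P (IG_mult B m u v)"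
    then show "P u"
    proof (induction rule: IG_induct)
      case (idempotent e)
      then have "e \<in> B" unfolding idem by simp
      then show ?case using idempotent by (auto simp: B_def)
    qed blast
  next
    fix x s assume "x \<in> band_carrier G A" "s \<in> carrier G \<times> J"
    then show "IG_act f (?\<rho> x) s = act G s x"
      using act_class[of "[enc x]" s] enc_B[of x] by (simp add: f)
  next
    fix u s assume "u \<in> IG_carrier B m" and s: "s \<in> carrier G \<times> J"
    then obtain w where w: "w \<in> lists (idempotents B m)" "u = IG_class B m w"
      by (elim IG_carrier_cases)
    show "IG_act f u s \<in> carrier G \<times> J"
      unfolding w(2) act_class[OF w(1) s] using w(1) s f_closed by (rule foldl_closed)
    fix v assume "v \<in> IG_carrier B m"
    then obtain w' where w': "w' \<in> lists (idempotents B m)" "v = IG_class B m w'"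
      by (elim IG_carrier_cases)
    have "foldl f s w \<in> carrier G \<times> J"
      using w(1) s f_closed by (rule foldl_closed)
    moreover have "w @ w' \<in> lists (idempotents B m)"
      using w w' by simp
    ultimately show "IG_act f (IG_mult B m u v) s = IG_act f v (IG_act f u s)"
      using act_class[OF w(1) s] act_class[OF w'(1)] act_class[OF _ s, of "w @ w'"]
      unfolding w(2) w'(2) by (simp only: IG_mult_class[OF w(1) w'(1)] foldl_append)
  next
    show "partial_homs_extend TYPE('e list set) G A" by (rule extension)
  qed
  then show "IG_has_maximal_subgroup_iso B m G"
    unfolding IG_has_maximal_subgroup_iso_def by (rule band_representation.maximal_subgroup_iso)
qed

end

text \<open>The lengths 3, 4 and 2 separate the three kinds of elements; the number summand stores
  the bits.\<close>

fun enc :: "'a elt \<Rightarrow> ('a + nat) list" where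
  "enc (Rect (c, k) (Gen a)) = [Inr (of_bool c), Inr (of_bool k), Inl a]"
| "enc (Rect (c, k) (Rel a b)) = [Inr (of_bool c), Inr (of_bool k), Inl a, Inl b]"
| "enc (Ext s t) = [Inr (of_bool s), Inr (of_bool t)]"

lemma inj_enc: "inj enc"
proof (rule injI)
  fix x y :: "'a elt"
  assume "enc x = enc y"
  then show "x = y"
    by (cases x rule: enc.cases; cases y rule: enc.cases)
      (auto simp: of_bool_def split: if_splits)
qed

lemma finite_band_carrier:
  assumes "finite A" shows "finite (band_carrier G A)"
proof -
  have "rows G A \<subseteq> Gen ` A \<union> (\<lambda>(a, b). Rel a b) ` (A \<times> A)"
    by (auto simp: rows_def)
  then have "finite (rows G A)"
    by (rule finite_subset) (use assms in simp)
  moreover have "band_carrier G A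
      = (\<lambda>(i, j). Rect i j) ` (UNIV \<times> rows G A) \<union> (\<lambda>(s, t). Ext s t) ` UNIV"
    by (auto simp: band_carrier_def)
  ultimately show ?thesis by simp
qed

theorem theorem1:
  fixes G :: "('a, 'm) monoid_scheme"
  assumes "group G"
  shows "(\<exists>(B :: ('a + nat) list set) m. is_band B m \<and> IG_has_maximal_subgroup_iso B m G) \<and>
         (finitely_presented G \<longrightarrow>
           (\<exists>(B :: ('a + nat) list set) m. is_band B m \<and> finite B \<and>
              IG_has_maximal_subgroup_iso B m G))"
proof (intro conjI impI)
  interpret group G by fact
  have "generate G (carrier G) = carrier G"
    using generate_incl[of "carrier G"] by (auto intro: generate.incl)
  then interpret partial_group G "carrier G"
    by unfold_locales auto
  \<comment> \<open>When A is the whole group, all products lie in A and \<theta> is already a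
    homomorphism.\<close>
  have "partial_homs_extend TYPE(('a + nat) list list set) G (carrier G)"
    unfolding partial_homs_extend_def
  proof (intro allI impI)
    fix H :: "('a + nat) list list set monoid" and \<theta>
    assume "group H \<and> \<theta> \<in> carrier G \<rightarrow> carrier H \<and> (\<forall>a\<in>carrier G. \<forall>b\<in>carrier G.
      a \<otimes>\<^bsub>G\<^esub> b \<in> carrier G \<longrightarrow> \<theta> (a \<otimes>\<^bsub>G\<^esub> b) = \<theta> a \<otimes>\<^bsub>H\<^esub> \<theta> b)"
    then show "\<exists>\<psi>\<in>hom G H. \<forall>a\<in>carrier G. \<psi> a = \<theta> a"
      by (intro bexI[of _ \<theta>] homI) auto
  qed
  note band_encoded[OF inj_enc this]
  then show "\<exists>(B :: ('a + nat) list set) m. is_band B m \<and> IG_has_maximal_subgroup_iso B m G"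
    by (intro exI conjI)
next
  assume "finitely_presented G"
  with assms obtain A where A: "finite A" "partial_group G A"
    and extension: "partial_homs_extend TYPE(('a + nat) list list set) G A"
    using finitely_presented_cover by blast
  interpret partial_group G A by (fact A(2))
  have "finite (enc ` band_carrier G A)"
    using A(1) by (intro finite_imageI finite_band_carrier)
  with band_encoded[OF inj_enc extension]
  show "\<exists>(B :: ('a + nat) list set) m. is_band B m \<and> finite B \<and> IG_has_maximal_subgroup_iso B m G"
    by (intro exI conjI)
qed

end
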